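(* Let $G$ be a connected graph and $\mathcal{B}$ its set of blocks. (i) $\mathrm{CBP}(G)$ is simple if and only if $G$ has at most one cut vertex. (ii) $\mathrm{CBP}(G)$ is simplicial if and only if $|\mathcal{B}|\le2$.
   Context: Graphs are finite, simple and undirected. A connected graph is 2-connected if it has at least three vertices and remains connected after deleting any single vertex. A bridge is an edge whose deletion increases the number of connected components. A block of $G$ is a maximal 2-connected subgraph of $G$ or a bridge together with its two end vertices; $\mathcal{B}$ denotes the set of blocks of $G$. A cut vertex is a vertex whose deletion increases the number of connected components. For $\mathcal{A}\subseteq\mathcal{B}$ let $G[\mathcal{A}]=\bigcup_{B\in\mathcal{A}}B$ (the empty graph counts as connected), and let $\chi^{\mathcal{A}}\in\{0,1\}^{\mathcal{B}}$ be the incidence vector of $\mathcal{A}$. The connected blocks polytope is $\mathrm{CBP}(G)=\mathrm{conv}\{\chi^{\mathcal{A}}\mid \mathcal{A}\subseteq\mathcal{B},\ G[\mathcal{A}]\text{ connected}\}\subseteq\mathbb{R}^{\mathcal{B}}$. A $d$-dimensional polytope is simple if every vertex is contained in exactly $d$ edges (equivalently, every vertex figure is a simplex), and simplicial if every proper face is a simplex. *)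

theory Defs
  imports "HOL-Analysis.Analysis"
begin

section \<open>Finite simple undirected graphs\<close>

type_synonym 'a ugraph = "'a set \<times> 'a set set"

abbreviation verts :: "'a ugraph \<Rightarrow> 'a set" where "verts \<equiv> fst"
abbreviation edges :: "'a ugraph \<Rightarrow> 'a set set" where "edges \<equiv> snd"

definition simple_graph :: "'a ugraph \<Rightarrow> bool" where
  "simple_graph G \<longleftrightarrow> finite (verts G) \<and> (\<forall>e\<in>edges G. e \<subseteq> verts G \<and> card e = 2)"

definition adjacency :: "'a ugraph \<Rightarrow> 'a rel" where
  "adjacency G = {(u, v). {u, v} \<in> edges G}"

text \<open>The empty graph counts as connected.\<close>

definition connected_graph :: "'a ugraph \<Rightarrow> bool" where
  "connected_graph G \<longleftrightarrow> (\<forall>u\<in>verts G. \<forall>v\<in>verts G. (u, v) \<in> (adjacency G)\<^sup>*)"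

definition components_graph :: "'a ugraph \<Rightarrow> 'a set set" where
  "components_graph G = {{v \<in> verts G. (u, v) \<in> (adjacency G)\<^sup>*} | u. u \<in> verts G}"

definition delete_vertex :: "'a ugraph \<Rightarrow> 'a \<Rightarrow> 'a ugraph" where
  "delete_vertex G v = (verts G - {v}, {e \<in> edges G. v \<notin> e})"

definition delete_edge :: "'a ugraph \<Rightarrow> 'a set \<Rightarrow> 'a ugraph" where
  "delete_edge G e = (verts G, edges G - {e})"

definition subgraph :: "'a ugraph \<Rightarrow> 'a ugraph \<Rightarrow> bool" where
  "subgraph H G \<longleftrightarrow> simple_graph H \<and> verts H \<subseteq> verts G \<and> edges H \<subseteq> edges G"

definition cut_vertex :: "'a ugraph \<Rightarrow> 'a \<Rightarrow> bool" where
  "cut_vertex G v \<longleftrightarrow> v \<in> verts G \<and>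
     card (components_graph (delete_vertex G v)) > card (components_graph G)"

definition bridge :: "'a ugraph \<Rightarrow> 'a set \<Rightarrow> bool" where
  "bridge G e \<longleftrightarrow> e \<in> edges G \<and>
     card (components_graph (delete_edge G e)) > card (components_graph G)"

definition two_connected :: "'a ugraph \<Rightarrow> bool" where
  "two_connected G \<longleftrightarrow> connected_graph G \<and> card (verts G) \<ge> 3 \<and>
     (\<forall>v\<in>verts G. connected_graph (delete_vertex G v))"

definition maximal_two_connected_subgraph :: "'a ugraph \<Rightarrow> 'a ugraph \<Rightarrow> bool" where
  "maximal_two_connected_subgraph H G \<longleftrightarrow> subgraph H G \<and> two_connected H \<and>
     (\<forall>K. subgraph K G \<and> two_connected K \<and> subgraph H K \<longrightarrow> K = H)"

definition blocks :: "'a ugraph \<Rightarrow> 'a ugraph set" where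
  "blocks G = {H. maximal_two_connected_subgraph H G} \<union> {(e, {e}) | e. bridge G e}"

definition union_graph :: "'a ugraph set \<Rightarrow> 'a ugraph" where
  "union_graph A = (\<Union>B\<in>A. verts B, \<Union>B\<in>A. edges B)"


section \<open>The connected blocks polytope\<close>

text \<open>
  The set of blocks of a graph is not a type. For a finite vertex type \<open>'a\<close>, however, \<open>'a ugraph\<close>
  is a finite type containing all blocks, so \<open>real ^ 'a ugraph\<close> has one coordinate for every
  potential block. The space of real vectors indexed by \<open>blocks G\<close> is identified with the
  coordinate subspace of those vectors that vanish at every index outside \<open>blocks G\<close>; it may be
  the zero space, which occurs when \<open>G\<close> has no edges.
\<close>

definition incidence_vector :: "'a::finite ugraph set \<Rightarrow> real ^ 'a ugraph" where
  "incidence_vector A = (\<chi> B. if B \<in> A then 1 else 0)"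

definition CBP :: "'a::finite ugraph \<Rightarrow> (real ^ 'a ugraph) set" where
  "CBP G = convex hull
     {incidence_vector A | A. A \<subseteq> blocks G \<and> connected_graph (union_graph A)}"


section \<open>Simple and simplicial polytopes\<close>

text \<open>
  The dimension is that of the affine hull, hence independent of the ambient space.
\<close>

definition simple_polytope :: "'v::euclidean_space set \<Rightarrow> bool" where
  "simple_polytope P \<longleftrightarrow> polytope P \<and>
     (\<forall>x. x extreme_point_of P \<longrightarrow> int (card {e. e edge_of P \<and> x \<in> e}) = aff_dim P)"

text \<open>The empty face is covered as well; it is a simplex of dimension \<open>-1\<close>.\<close>

definition simplicial_polytope :: "'v::euclidean_space set \<Rightarrow> bool" where
  "simplicial_polytope P \<longleftrightarrow> polytope P \<and>
     (\<forall>F. F face_of P \<and> F \<noteq> P \<longrightarrow> (\<exists>n. n simplex F))"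

end

theory Submission
  imports Defs
begin

text \<open>
  Call two blocks adjacent if they share a vertex. Since a vertex common to two blocks is a cut
  vertex, and conversely a cut vertex \<open>x\<close> has blocks on its far side from any other vertex,
  \<open>G\<close> has at most one cut vertex iff all blocks are pairwise adjacent. In that case every set of
  blocks has a connected union and \<open>CBP G\<close> is a cube. Otherwise the block adjacency relation, being
  connected, has an induced path \<open>A, B, C\<close>, and the vertex of \<open>{A}\<close> lies on more than
  \<open>card (blocks G)\<close> edges: its neighbours include \<open>{}\<close>, the set \<open>{A, D}\<close> or \<open>{D}\<close> for each
  further block \<open>D\<close> (according to whether \<open>D\<close> is adjacent to \<open>A\<close>), and \<open>{A, B, C}\<close>.

  The dimension is \<open>card (blocks G)\<close>, so proper faces are at most segments if there are at most two
  blocks. With a third block, any two adjacent blocks \<open>A, B\<close> yield a proper square face, spanned by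
  the subsets of \<open>{A, B}\<close>.
\<close>

section \<open>Connectivity of graphs\<close>

lemma sym_adjacency_rtrancl: "sym ((adjacency G)\<^sup>*)"
  by (rule sym_rtrancl) (auto simp: sym_def adjacency_def insert_commute)

lemma adjacency_rtrancl_commute:
  "(u, v) \<in> (adjacency G)\<^sup>* \<Longrightarrow> (v, u) \<in> (adjacency G)\<^sup>*"
  using sym_adjacency_rtrancl by (metis symD)

lemma adjacency_rtrancl_mono:
  assumes "(u, v) \<in> (adjacency G)\<^sup>*" "edges G \<subseteq> edges H"
  shows "(u, v) \<in> (adjacency H)\<^sup>*"
proof -
  have "adjacency G \<subseteq> adjacency H"
    using assms(2) by (auto simp: adjacency_def)
  then show ?thesis
    using assms(1) rtrancl_mono by blast
qed

lemma connected_graphI_hub: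
  assumes "\<And>u. u \<in> verts G \<Longrightarrow> (u, c) \<in> (adjacency G)\<^sup>*"
  shows "connected_graph G"
  unfolding connected_graph_def
  using assms adjacency_rtrancl_commute by (meson rtrancl_trans)

text \<open>Every vertex of \<open>K\<close> walks to \<open>W\<close> inside \<open>K\<close>, and
  from there to a fixed vertex \<open>c\<close> of \<open>W\<close>. The condition on
  \<open>K\<close> is stated by reachability because \<open>K\<close> will be a graph with a vertex
  deleted, which may fall into several pieces.\<close>

lemma connected_graph_attach:
  assumes W: "connected_graph W"
    and K: "\<And>x. x \<in> verts K \<Longrightarrow> \<exists>y\<in>verts W. (x, y) \<in> (adjacency K)\<^sup>*"
  shows "connected_graph (union_graph {W, K})"
proof (cases "verts W = {}")
  case True
  then have "verts K = {}"
    using K by blast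
  with True show ?thesis
    by (simp add: connected_graph_def union_graph_def)
next
  case False
  then obtain c where c: "c \<in> verts W" by blast
  have W_c: "(x, c) \<in> (adjacency (union_graph {W, K}))\<^sup>*" if "x \<in> verts W" for x
  proof (rule adjacency_rtrancl_mono)
    show "(x, c) \<in> (adjacency W)\<^sup>*"
      using W c that by (simp add: connected_graph_def)
  qed (simp add: union_graph_def)
  show ?thesis
  proof (rule connected_graphI_hub[of _ c])
    fix u assume "u \<in> verts (union_graph {W, K})"
    then consider "u \<in> verts W" | "u \<in> verts K"
      by (auto simp: union_graph_def)
    then show "(u, c) \<in> (adjacency (union_graph {W, K}))\<^sup>*"
    proof cases
      case 2
      then obtain y where "y \<in> verts W" "(u, y) \<in> (adjacency K)\<^sup>*"
        using K by blast
      then have "(u, y) \<in> (adjacency (union_graph {W, K}))\<^sup>*"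
        by (elim adjacency_rtrancl_mono) (simp add: union_graph_def)
      then show ?thesis
        using W_c[OF \<open>y \<in> verts W\<close>] by (rule rtrancl_trans)
    qed (rule W_c)
  qed
qed

lemma edges_mem_union_graph: "A \<in> \<A> \<Longrightarrow> edges A \<subseteq> edges (union_graph \<A>)"
  by (auto simp: union_graph_def)

lemma connected_graph_union_pairwise:
  assumes "\<And>A. A \<in> \<A> \<Longrightarrow> connected_graph A"
    and "\<And>A B. A \<in> \<A> \<Longrightarrow> B \<in> \<A> \<Longrightarrow> verts A \<inter> verts B \<noteq> {}"
  shows "connected_graph (union_graph \<A>)"
  unfolding connected_graph_def
proof (intro ballI)
  fix u v assume "u \<in> verts (union_graph \<A>)" "v \<in> verts (union_graph \<A>)"
  then obtain A B where AB: "A \<in> \<A>" "u \<in> verts A" "B \<in> \<A>" "v \<in> verts B"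
    by (auto simp: union_graph_def)
  then obtain z where z: "z \<in> verts A" "z \<in> verts B"
    using assms(2) by blast
  have "(u, z) \<in> (adjacency A)\<^sup>*" "(z, v) \<in> (adjacency B)\<^sup>*"
    using assms(1) AB z by (auto simp: connected_graph_def)
  then have "(u, z) \<in> (adjacency (union_graph \<A>))\<^sup>*" "(z, v) \<in> (adjacency (union_graph \<A>))\<^sup>*"
    using AB by (blast intro: adjacency_rtrancl_mono[OF _ edges_mem_union_graph])+
  then show "(u, v) \<in> (adjacency (union_graph \<A>))\<^sup>*"
    by (rule rtrancl_trans)
qed

text \<open>A walk that starts in \<open>A\<close> never leaves \<open>A\<close>: an edge of
  \<open>B\<close> has both ends in \<open>B\<close>, so it cannot be used from a vertex of
  \<open>A\<close>.\<close>

lemma not_connected_graph_disjoint_union: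
  assumes "simple_graph A" "simple_graph B"
    and "verts A \<noteq> {}" "verts B \<noteq> {}" "verts A \<inter> verts B = {}"
  shows "\<not> connected_graph (union_graph {A, B})"
proof
  assume conn: "connected_graph (union_graph {A, B})"
  obtain a b where ab: "a \<in> verts A" "b \<in> verts B"
    using assms by blast
  then have "(a, b) \<in> (adjacency (union_graph {A, B}))\<^sup>*"
    using conn by (auto simp: connected_graph_def union_graph_def)
  then have "b \<in> verts A"
  proof induction
    case (step y z)
    then show ?case
      using assms by (fastforce simp: adjacency_def union_graph_def simple_graph_def)
  qed (use ab in simp)
  then show False
    using ab assms by blast
qed

text \<open>The bound is \<open>\<le> 1\<close> and not \<open>= 1\<close> because the empty graph
  is connected and has no component. Components are the values of \<open>?c\<close>, so there is at
  most one exactly if all these values agree.\<close>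

lemma connected_graph_iff_card_components:
  assumes "finite (verts G)"
  shows "connected_graph G \<longleftrightarrow> card (components_graph G) \<le> 1"
proof -
  let ?c = "\<lambda>u. {v \<in> verts G. (u, v) \<in> (adjacency G)\<^sup>*}"
  have comp: "components_graph G = ?c ` verts G"
    by (auto simp: components_graph_def)
  have "card (components_graph G) \<le> 1 \<longleftrightarrow> (\<forall>u\<in>verts G. \<forall>v\<in>verts G. ?c u = ?c v)"
    using assms by (auto simp: comp card_le_Suc0_iff_eq)
  also have "\<dots> \<longleftrightarrow> connected_graph G"
  proof
    assume eq: "\<forall>u\<in>verts G. \<forall>v\<in>verts G. ?c u = ?c v"
    show "connected_graph G"
      unfolding connected_graph_def
    proof (intro ballI)
      fix u v assume "u \<in> verts G" "v \<in> verts G"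
      then have "v \<in> ?c u" using eq by blast
      then show "(u, v) \<in> (adjacency G)\<^sup>*" by simp
    qed
  next
    assume "connected_graph G"
    then show "\<forall>u\<in>verts G. \<forall>v\<in>verts G. ?c u = ?c v"
      unfolding connected_graph_def by blast
  qed
  finally show ?thesis by simp
qed

lemma card_components_connected:
  assumes "finite (verts G)" "connected_graph G" "verts G \<noteq> {}"
  shows "card (components_graph G) = 1"
proof -
  have "finite (components_graph G)" "components_graph G \<noteq> {}"
    using assms by (auto simp: components_graph_def)
  then have "card (components_graph G) \<noteq> 0"
    by simp
  moreover have "card (components_graph G) \<le> 1"
    using assms connected_graph_iff_card_components by blast
  ultimately show ?thesis by linarith
qed

text \<open>A connected graph with a vertex has exactly one component, so having more components
  after the deletion means having at least two.\<close>

lemma cut_vertex_iff: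
  assumes "simple_graph G" "connected_graph G"
  shows "cut_vertex G v \<longleftrightarrow> v \<in> verts G \<and> \<not> connected_graph (delete_vertex G v)"
proof (cases "v \<in> verts G")
  case True
  have "finite (verts G)" "finite (verts (delete_vertex G v))"
    using assms by (auto simp: simple_graph_def delete_vertex_def)
  moreover from this have "card (components_graph G) = 1"
    using True assms by (intro card_components_connected) auto
  ultimately show ?thesis
    using True connected_graph_iff_card_components[of "delete_vertex G v"]
    by (auto simp: cut_vertex_def)
qed (simp add: cut_vertex_def)

lemma bridge_iff:
  assumes "simple_graph G" "connected_graph G"
  shows "bridge G e \<longleftrightarrow> e \<in> edges G \<and> \<not> connected_graph (delete_edge G e)"
proof (cases "e \<in> edges G")
  case True
  then have "card e = 2" "e \<subseteq> verts G"
    using assms by (auto simp: simple_graph_def)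
  then have "verts G \<noteq> {}" by auto
  moreover have "finite (verts G)" "finite (verts (delete_edge G e))"
    using assms by (auto simp: simple_graph_def delete_edge_def)
  moreover from calculation have "card (components_graph G) = 1"
    using assms by (intro card_components_connected) auto
  ultimately show ?thesis
    using True connected_graph_iff_card_components[of "delete_edge G e"]
    by (auto simp: bridge_def)
qed (simp add: bridge_def)

lemma simple_graph_edgeE:
  assumes "simple_graph G" "e \<in> edges G"
  obtains a b where "e = {a, b}" "a \<noteq> b" "a \<in> verts G" "b \<in> verts G"
proof -
  have "e \<subseteq> verts G" "card e = 2"
    using assms by (auto simp: simple_graph_def)
  then show ?thesis
    using that by (auto simp: card_2_iff)
qed

section \<open>Paths and the attachment of ears\<close>

definition path_graph :: "(nat \<Rightarrow> 'a) \<Rightarrow> nat \<Rightarrow> 'a ugraph" where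
  "path_graph p n = (p ` {..n}, (\<lambda>i. {p i, p (Suc i)}) ` {..<n})"

text \<open>A shortest walk repeats no vertex: if \<open>p i = p j\<close> with
  \<open>i < j\<close>, cutting out the part between them would give a shorter walk.\<close>

lemma obtain_path:
  assumes "(a, b) \<in> (adjacency G)\<^sup>*"
  obtains p n where "p 0 = a" "p n = b" "inj_on p {..n}"
    "edges (path_graph p n) \<subseteq> edges G"
proof -
  let ?R = "adjacency G"
  define n where "n = (LEAST n. (a, b) \<in> ?R ^^ n)"
  have n: "(a, b) \<in> ?R ^^ n"
    unfolding n_def using rtrancl_imp_relpow[OF assms] by (meson LeastI_ex)
  have least: "n \<le> m" if "(a, b) \<in> ?R ^^ m" for m
    unfolding n_def using that by (rule Least_le)
  obtain p where p: "p 0 = a" "p n = b" "\<And>i. i < n \<Longrightarrow> (p i, p (Suc i)) \<in> ?R"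
    using n by (auto simp: relpow_fun_conv)
  have seg: "(p i, p (i + k)) \<in> ?R ^^ k" if "i + k \<le> n" for i k
    unfolding relpow_fun_conv using that p(3) by (intro exI[of _ "\<lambda>l. p (i + l)"]) auto
  have False if "i < j" "j \<le> n" "p i = p j" for i j
  proof -
    have "(a, p i) \<in> ?R ^^ i" "(p j, b) \<in> ?R ^^ (n - j)"
      using seg[of 0 i] seg[of j "n - j"] that p(1,2) by auto
    then have "(a, b) \<in> ?R ^^ (i + (n - j))"
      unfolding relpow_add using that(3) by (metis relcompI)
    with least that show False by fastforce
  qed
  then have "inj_on p {..n}"
    by (metis (no_types, lifting) atMost_iff inj_onI linorder_neqE_nat)
  moreover have "edges (path_graph p n) \<subseteq> edges G"
    using p(3) by (auto simp: path_graph_def adjacency_def)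
  ultimately show ?thesis
    using that p by blast
qed

lemma path_graph_delete_vertex_segment:
  assumes "a \<le> b" "b \<le> n" "\<And>l. a \<le> l \<Longrightarrow> l \<le> b \<Longrightarrow> p l \<noteq> v"
  shows "(p a, p b) \<in> (adjacency (delete_vertex (path_graph p n) v))\<^sup>*"
  using assms
proof (induction b rule: dec_induct)
  case (step m)
  have "{p m, p (Suc m)} \<in> edges (path_graph p n)" "v \<notin> {p m, p (Suc m)}"
    using step.hyps step.prems(1) step.prems(2)[of m] step.prems(2)[of "Suc m"]
    by (auto simp: path_graph_def)
  then have "(p m, p (Suc m)) \<in> adjacency (delete_vertex (path_graph p n) v)"
    by (simp add: adjacency_def delete_vertex_def)
  moreover have "(p a, p m) \<in> (adjacency (delete_vertex (path_graph p n) v))\<^sup>*"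
    using step by auto
  ultimately show ?case by (rule rtrancl_into_rtrancl[rotated])
qed simp

text \<open>By injectivity \<open>v\<close> occurs at most once on the path, so from
  \<open>x\<close> at least one of the two directions along the path is free of
  \<open>v\<close>.\<close>

lemma path_graph_delete_vertex_reaches_end:
  assumes "inj_on p {..n}" "x \<in> verts (delete_vertex (path_graph p n) v)"
  shows "\<exists>y\<in>{p 0, p n} - {v}. (x, y) \<in> (adjacency (delete_vertex (path_graph p n) v))\<^sup>*"
proof -
  obtain i where i: "i \<le> n" "x = p i" "p i \<noteq> v"
    using assms(2) by (auto simp: path_graph_def delete_vertex_def)
  show ?thesis
  proof (cases "\<exists>j\<le>i. p j = v")
    case False
    then have "(p 0, p i) \<in> (adjacency (delete_vertex (path_graph p n) v))\<^sup>*"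
      using i by (intro path_graph_delete_vertex_segment) auto
    then show ?thesis
      using False i by (auto intro: adjacency_rtrancl_commute)
  next
    case True
    then obtain j where j: "j < i" "p j = v"
      using i le_neq_implies_less by blast
    have "p l \<noteq> v" if "i \<le> l" "l \<le> n" for l
      using that j i assms(1) by (auto dest: inj_onD)
    then have "(p i, p n) \<in> (adjacency (delete_vertex (path_graph p n) v))\<^sup>*" "p n \<noteq> v"
      using i by (auto intro: path_graph_delete_vertex_segment)
    then show ?thesis
      using i by auto
  qed
qed

lemma connected_path_graph_delete_vertex:
  assumes "v \<notin> p ` {..n}"
  shows "connected_graph (delete_vertex (path_graph p n) v)"
proof (rule connected_graphI_hub[of _ "p 0"])
  fix u assume "u \<in> verts (delete_vertex (path_graph p n) v)"
  then obtain i where "i \<le> n" "u = p i"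
    by (auto simp: path_graph_def delete_vertex_def)
  moreover have "(p 0, p i) \<in> (adjacency (delete_vertex (path_graph p n) v))\<^sup>*"
    using assms \<open>i \<le> n\<close> by (intro path_graph_delete_vertex_segment) auto
  ultimately show "(u, p 0) \<in> (adjacency (delete_vertex (path_graph p n) v))\<^sup>*"
    by (simp add: adjacency_rtrancl_commute)
qed

lemma delete_vertex_union_graph:
  "delete_vertex (union_graph {A, B}) v = union_graph {delete_vertex A v, delete_vertex B v}"
  by (auto simp: delete_vertex_def union_graph_def)

text \<open>There are two ways for an ear to leave the graph connected after deleting
  \<open>v\<close>. Either \<open>W\<close> without \<open>v\<close> is connected, and every
  remaining vertex of the ear runs along it to a surviving end; or \<open>W\<close> falls apart, but
  the ear avoids \<open>v\<close> and its ends meet every piece. The second case serves two blocks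
  glued at \<open>v\<close>.\<close>

lemma connected_delete_vertex_ear:
  assumes inj: "inj_on p {..n}" and ends: "p 0 \<in> verts W" "p n \<in> verts W"
    and W: "connected_graph (delete_vertex W v) \<or>
      v \<notin> p ` {..n} \<and>
      (\<forall>w\<in>verts (delete_vertex W v). \<exists>y\<in>{p 0, p n}. (w, y) \<in> (adjacency (delete_vertex W v))\<^sup>*)"
  shows "connected_graph (delete_vertex (union_graph {W, path_graph p n}) v)"
  using W
proof
  assume "connected_graph (delete_vertex W v)"
  moreover have "\<exists>y\<in>verts (delete_vertex W v). (x, y) \<in> (adjacency (delete_vertex (path_graph p n) v))\<^sup>*"
    if "x \<in> verts (delete_vertex (path_graph p n) v)" for x
    using path_graph_delete_vertex_reaches_end[OF inj that] ends by (auto simp: delete_vertex_def)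
  ultimately show ?thesis
    unfolding delete_vertex_union_graph by (rule connected_graph_attach)
next
  assume *: "v \<notin> p ` {..n} \<and>
    (\<forall>w\<in>verts (delete_vertex W v). \<exists>y\<in>{p 0, p n}. (w, y) \<in> (adjacency (delete_vertex W v))\<^sup>*)"
  then have "{p 0, p n} \<subseteq> verts (delete_vertex (path_graph p n) v)"
    by (auto simp: delete_vertex_def path_graph_def)
  \<comment> \<open>The roles are exchanged here: the pieces of \<open>W\<close> are attached to the
    intact path.\<close>
  with * have "connected_graph (union_graph {delete_vertex (path_graph p n) v, delete_vertex W v})"
    by (intro connected_graph_attach connected_path_graph_delete_vertex) blast+
  then show ?thesis
    by (simp add: delete_vertex_union_graph insert_commute)
qed

section \<open>2-connected subgraphs, bridges and the block of an edge\<close>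

text \<open>Connectivity of \<open>H\<close> itself comes for free: any two vertices leave a third
  one \<open>v\<close>, and they are joined already after deleting it.\<close>

lemma two_connectedI:
  assumes card: "card (verts H) \<ge> 3"
    and del: "\<And>v. connected_graph (delete_vertex H v)"
  shows "two_connected H"
proof -
  have "connected_graph H"
    unfolding connected_graph_def
  proof (intro ballI)
    fix u w assume uw: "u \<in> verts H" "w \<in> verts H"
    have "card {u, w} < card (verts H)"
      using card by (cases "u = w") auto
    then have "\<not> verts H \<subseteq> {u, w}"
      using card_mono[of "{u, w}" "verts H"] by auto
    then obtain v where "v \<in> verts H" "v \<noteq> u" "v \<noteq> w" by blast
    then have "(u, w) \<in> (adjacency (delete_vertex H v))\<^sup>*"
      using del[of v] uw by (auto simp: connected_graph_def delete_vertex_def)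
    then show "(u, w) \<in> (adjacency H)\<^sup>*"
      by (rule adjacency_rtrancl_mono) (auto simp: delete_vertex_def)
  qed
  then show ?thesis
    using assms by (auto simp: two_connected_def)
qed

lemma subgraph_trans: "subgraph A B \<Longrightarrow> subgraph B C \<Longrightarrow> subgraph A C"
  by (auto simp: subgraph_def)

lemma subgraph_union_graph:
  assumes "subgraph A G" "subgraph B G"
  shows "subgraph (union_graph {A, B}) G"
    and "subgraph A (union_graph {A, B})" "subgraph B (union_graph {A, B})"
  using assms by (auto simp: subgraph_def union_graph_def simple_graph_def)

lemma subgraph_path_graph:
  assumes "simple_graph G" "p 0 \<in> verts G" "edges (path_graph p n) \<subseteq> edges G"
  shows "subgraph (path_graph p n) G"
proof -
  have "p i \<in> verts G" if "i \<le> n" for i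
  proof (cases i)
    case (Suc j)
    then have "{p j, p i} \<in> edges G"
      using that assms(3) by (auto simp: path_graph_def)
    then show ?thesis
      using assms(1) by (auto simp: simple_graph_def)
  qed (use assms in simp)
  then show ?thesis
    using assms by (auto simp: subgraph_def simple_graph_def path_graph_def)
qed

text \<open>Over a finite vertex type there are finitely many candidates, so one of them maximises
  the number of vertices plus the number of edges. A candidate containing it has equally many of
  both and hence equals it.\<close>

lemma two_connected_subgraph_of_maximal:
  fixes G :: "'a::finite ugraph"
  assumes "subgraph H G" "two_connected H"
  obtains M where "maximal_two_connected_subgraph M G" "subgraph H M"
proof -
  let ?S = "{K. subgraph K G \<and> two_connected K \<and> subgraph H K}"
  let ?f = "\<lambda>K :: 'a ugraph. card (verts K) + card (edges K)"
  have "H \<in> ?S"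
    using assms by (auto simp: subgraph_def)
  moreover have "finite ?S" by simp
  ultimately have "Max (?f ` ?S) \<in> ?f ` ?S"
    by (intro Max_in finite_imageI) blast+
  then obtain M where M: "M \<in> ?S" "?f M = Max (?f ` ?S)" by force
  then have max: "?f K \<le> ?f M" if "K \<in> ?S" for K
    using that by (simp only: M(2)) (intro Max_ge; simp)
  have "K = M" if K: "subgraph K G" "two_connected K" "subgraph M K" for K
  proof -
    have sub: "verts M \<subseteq> verts K" "edges M \<subseteq> edges K"
      using K by (auto simp: subgraph_def)
    have "card (verts M) \<le> card (verts K)" "card (edges M) \<le> card (edges K)"
      by (intro card_mono sub; simp)+
    moreover have "?f K \<le> ?f M"
      using M K by (intro max) (auto intro: subgraph_trans)
    ultimately have "card (verts M) = card (verts K)" "card (edges M) = card (edges K)"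
      by linarith+
    then have "verts M = verts K" "edges M = edges K"
      by (intro card_subset_eq sub finite; simp)+
    then show ?thesis by (simp add: prod_eq_iff)
  qed
  then have "maximal_two_connected_subgraph M G"
    using M unfolding maximal_two_connected_subgraph_def by blast
  then show ?thesis
    using M that by blast
qed

text \<open>For a third vertex \<open>w\<close> of \<open>H\<close>, a walk from \<open>a\<close> to
  \<open>w\<close> avoiding \<open>b\<close> followed by one from \<open>w\<close> to
  \<open>b\<close> avoiding \<open>a\<close> does not use the edge \<open>e\<close>. This detour
  replaces \<open>e\<close> in every walk of \<open>G\<close>.\<close>

lemma not_bridge_in_two_connected:
  fixes G :: "'a::finite ugraph"
  assumes G: "simple_graph G" "connected_graph G"
    and H: "subgraph H G" "two_connected H" and e: "e \<in> edges H"
  shows "\<not> bridge G e"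
proof -
  have "simple_graph H" using H by (simp add: subgraph_def)
  then obtain a b where ab: "e = {a, b}" "a \<noteq> b" "a \<in> verts H" "b \<in> verts H"
    using e by (rule simple_graph_edgeE)
  have "card {a, b} < card (verts H)"
    using H ab by (auto simp: two_connected_def)
  then have "\<not> verts H \<subseteq> {a, b}"
    using card_mono[of "{a, b}" "verts H"] by auto
  then obtain w where w: "w \<in> verts H" "w \<noteq> a" "w \<noteq> b" by blast
  have "(a, w) \<in> (adjacency (delete_vertex H b))\<^sup>*" "(w, b) \<in> (adjacency (delete_vertex H a))\<^sup>*"
    using H(2) w ab by (auto simp: two_connected_def connected_graph_def delete_vertex_def)
  moreover have "edges (delete_vertex H b) \<subseteq> edges (delete_edge G e)"
    "edges (delete_vertex H a) \<subseteq> edges (delete_edge G e)"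
    using H(1) ab by (auto simp: delete_vertex_def delete_edge_def subgraph_def)
  ultimately have "(a, b) \<in> (adjacency (delete_edge G e))\<^sup>*"
    by (meson adjacency_rtrancl_mono rtrancl_trans)
  then have e_conn: "(b, a) \<in> (adjacency (delete_edge G e))\<^sup>*" "(a, b) \<in> (adjacency (delete_edge G e))\<^sup>*"
    by (auto intro: adjacency_rtrancl_commute)
  have "adjacency G \<subseteq> (adjacency (delete_edge G e))\<^sup>*"
  proof clarify
    fix u v assume uv: "(u, v) \<in> adjacency G"
    show "(u, v) \<in> (adjacency (delete_edge G e))\<^sup>*"
    proof (cases "{u, v} = e")
      case True
      then show ?thesis using e_conn ab by (auto simp: doubleton_eq_iff)
    next
      case False
      then show ?thesis using uv by (auto simp: adjacency_def delete_edge_def)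
    qed
  qed
  then have "(adjacency G)\<^sup>* \<subseteq> (adjacency (delete_edge G e))\<^sup>*"
    by (rule rtrancl_subset_rtrancl)
  then have "connected_graph (delete_edge G e)"
    using G by (auto simp: connected_graph_def delete_edge_def)
  then show ?thesis
    using G by (simp add: bridge_iff)
qed

lemma connected_delete_vertex_single_edge:
  "connected_graph (delete_vertex ({a, b}, {{a, b}}) v)"
proof (rule connected_graphI_hub[of _ "if v = a then b else a"])
  fix u assume u: "u \<in> verts (delete_vertex ({a, b}, {{a, b}}) v)"
  show "(u, if v = a then b else a) \<in> (adjacency (delete_vertex ({a, b}, {{a, b}}) v))\<^sup>*"
  proof (cases "u = (if v = a then b else a)")
    case False
    with u have "u = b" "v \<noteq> a" "v \<noteq> b"
      by (auto simp: delete_vertex_def split: if_splits)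
    then show ?thesis
      by (auto simp: delete_vertex_def adjacency_def insert_commute)
  qed simp
qed

text \<open>A bridge is a block by itself. Any other edge closes a cycle with a path between its
  ends that avoids it; the cycle is 2-connected and therefore lies in a maximal 2-connected
  subgraph.\<close>

lemma edge_in_block:
  fixes G :: "'a::finite ugraph"
  assumes G: "simple_graph G" "connected_graph G" and e: "e \<in> edges G"
  shows "\<exists>B\<in>blocks G. e \<in> edges B"
proof (cases "bridge G e")
  case True
  then have "(e, {e}) \<in> blocks G" by (simp add: blocks_def)
  then show ?thesis by force
next
  case False
  obtain a b where ab: "e = {a, b}" "a \<noteq> b" "a \<in> verts G" "b \<in> verts G"
    using G(1) e by (rule simple_graph_edgeE)
  have "connected_graph (delete_edge G e)"
    using False G e by (simp add: bridge_iff)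
  then have "(a, b) \<in> (adjacency (delete_edge G e))\<^sup>*"
    using ab by (auto simp: connected_graph_def delete_edge_def)
  then obtain p n where p: "p 0 = a" "p n = b" "inj_on p {..n}"
    "edges (path_graph p n) \<subseteq> edges (delete_edge G e)"
    by (rule obtain_path)
  \<comment> \<open>The cycle is built as the single edge \<open>e\<close> with the path attached as
    an ear.\<close>
  let ?W = "({a, b}, {{a, b}})"
  let ?H = "union_graph {?W, path_graph p n}"
  have "subgraph (path_graph p n) G"
    using p ab G by (intro subgraph_path_graph) (auto simp: delete_edge_def)
  moreover have "subgraph ?W G"
    using ab e by (auto simp: subgraph_def simple_graph_def)
  ultimately have sub: "subgraph ?H G" "subgraph (path_graph p n) ?H"
    by (auto dest: subgraph_union_graph)
  have "n \<noteq> 0" using p(1,2) ab(2) by metis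
  then have "{p 0, p 1} \<in> edges (delete_edge G e)"
    using p(4) by (force simp: path_graph_def)
  \<comment> \<open>Otherwise the first edge of the path would be the deleted edge \<open>e\<close>.
    So \<open>p 1\<close> is a third vertex of the cycle.\<close>
  then have "p 1 \<noteq> b"
    using p ab by (auto simp: delete_edge_def)
  moreover have "p 1 \<noteq> a"
    using p(1,3) \<open>n \<noteq> 0\<close> by (auto dest: inj_onD)
  ultimately have "card {a, b, p 1} = 3"
    using ab by auto
  moreover have "{a, b, p 1} \<subseteq> verts ?H"
    using \<open>n \<noteq> 0\<close> by (auto simp: union_graph_def path_graph_def)
  ultimately have "3 \<le> card (verts ?H)"
    by (metis card_mono finite)
  then have "two_connected ?H"
    using p by (intro two_connectedI connected_delete_vertex_ear)
      (auto simp: connected_delete_vertex_single_edge)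
  then obtain M where "maximal_two_connected_subgraph M G" "subgraph ?H M"
    using sub(1) two_connected_subgraph_of_maximal by blast
  then have "M \<in> blocks G" "e \<in> edges M"
    using ab by (auto simp: blocks_def subgraph_def union_graph_def)
  then show ?thesis by blast
qed

section \<open>Basic properties of blocks\<close>

lemma blockE:
  assumes "B \<in> blocks G"
  obtains "maximal_two_connected_subgraph B G" | e where "bridge G e" "B = (e, {e})"
  using assms by (auto simp: blocks_def)

lemma block_subgraph:
  assumes "simple_graph G" "B \<in> blocks G"
  shows "subgraph B G"
  using assms(2)
proof (cases rule: blockE)
  case (2 e)
  then show ?thesis
    using assms(1) by (auto simp: bridge_def subgraph_def simple_graph_def intro: finite_subset)
qed (simp add: maximal_two_connected_subgraph_def)

text \<open>This is the property shared by both kinds of block on which the arguments below rest.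
  For a bridge, what remains is a single vertex or the edge itself; for a 2-connected block, a
  vertex \<open>v\<close> outside it changes nothing.\<close>

lemma connected_delete_vertex_block:
  assumes "simple_graph G" "B \<in> blocks G"
  shows "connected_graph (delete_vertex B v)"
  using assms(2)
proof (cases rule: blockE)
  case 1
  show ?thesis
  proof (cases "v \<in> verts B")
    case True
    with 1 show ?thesis
      by (auto simp: maximal_two_connected_subgraph_def two_connected_def)
  next
    case False
    have "simple_graph B"
      using assms by (auto dest: block_subgraph simp: subgraph_def)
    then have "delete_vertex B v = B"
      using False by (auto simp: delete_vertex_def simple_graph_def prod_eq_iff)
    with 1 show ?thesis
      by (simp add: maximal_two_connected_subgraph_def two_connected_def)
  qed
next
  case (2 e)
  then have "e \<in> edges G" by (simp add: bridge_def)
  then obtain a b where "e = {a, b}"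
    using assms(1) by (auto elim: simple_graph_edgeE)
  then show ?thesis
    using 2 by (simp add: connected_delete_vertex_single_edge)
qed

lemma connected_block:
  assumes "simple_graph G" "B \<in> blocks G"
  shows "connected_graph B"
  using assms(2)
proof (cases rule: blockE)
  case 1
  then show ?thesis
    by (simp add: maximal_two_connected_subgraph_def two_connected_def)
next
  case (2 e)
  then have "e \<in> edges G" by (simp add: bridge_def)
  then obtain a b where "e = {a, b}"
    using assms(1) by (auto elim: simple_graph_edgeE)
  then show ?thesis
    using 2 by (auto simp: connected_graph_def adjacency_def insert_commute intro!: r_into_rtrancl)
qed

lemma card_verts_block:
  assumes "simple_graph G" "B \<in> blocks G"
  shows "2 \<le> card (verts B)"
  using assms(2)
proof (cases rule: blockE)
  case (2 e)
  then show ?thesis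
    using assms(1) by (auto simp: bridge_def simple_graph_def)
qed (auto simp: maximal_two_connected_subgraph_def two_connected_def)

lemma block_other_vertex:
  assumes "simple_graph G" "B \<in> blocks G"
  obtains a where "a \<in> verts B" "a \<noteq> x"
proof -
  have "\<not> verts B \<subseteq> {x}"
    using card_verts_block[OF assms] card_mono[of "{x}" "verts B"] by auto
  then show ?thesis using that by blast
qed

lemma verts_block_nonempty:
  assumes "simple_graph G" "B \<in> blocks G"
  shows "verts B \<noteq> {}"
  using card_verts_block[OF assms] by auto

text \<open>If the common vertex \<open>x\<close> of two blocks were not a cut vertex, a path avoiding \<open>x\<close> would
  merge the two blocks into a larger 2-connected subgraph.\<close>

lemma common_vertex_of_blocks_is_cut_vertex:
  fixes G :: "'a::finite ugraph"
  assumes G: "simple_graph G" "connected_graph G"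
    and AB: "A \<in> blocks G" "B \<in> blocks G" "A \<noteq> B" and x: "x \<in> verts A" "x \<in> verts B"
  shows "cut_vertex G x"
proof (rule ccontr)
  assume "\<not> cut_vertex G x"
  note sub = block_subgraph[OF G(1) AB(1)] block_subgraph[OF G(1) AB(2)]
  have "x \<in> verts G" using x sub by (auto simp: subgraph_def)
  then have conn: "connected_graph (delete_vertex G x)"
    using \<open>\<not> cut_vertex G x\<close> G by (simp add: cut_vertex_iff)
  obtain a b where a: "a \<in> verts A" "a \<noteq> x" and b: "b \<in> verts B" "b \<noteq> x"
    using block_other_vertex[OF G(1)] AB by metis
  have ab: "a \<in> verts G" "b \<in> verts G"
    using a b sub by (auto simp: subgraph_def)
  then have "(a, b) \<in> (adjacency (delete_vertex G x))\<^sup>*"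
    using conn a b by (auto simp: connected_graph_def delete_vertex_def)
  then obtain p n where p: "p 0 = a" "p n = b" "inj_on p {..n}"
    and pG: "edges (path_graph p n) \<subseteq> edges (delete_vertex G x)"
    by (rule obtain_path)
  have "simple_graph (delete_vertex G x)"
    using G by (auto simp: simple_graph_def delete_vertex_def)
  then have P: "subgraph (path_graph p n) (delete_vertex G x)"
    using p pG ab a by (intro subgraph_path_graph) (auto simp: delete_vertex_def)
  then have xP: "x \<notin> p ` {..n}" and PG: "subgraph (path_graph p n) G"
    by (auto simp: subgraph_def delete_vertex_def path_graph_def)
  let ?W = "union_graph {A, B}"
  let ?H = "union_graph {?W, path_graph p n}"
  have W: "subgraph ?W G" "subgraph A ?W" "subgraph B ?W"
    using subgraph_union_graph sub by blast+
  have H: "subgraph ?H G" "subgraph A ?H" "subgraph B ?H"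
    using subgraph_union_graph[OF W(1) PG] W subgraph_trans by blast+
  have del: "connected_graph (delete_vertex ?H v)" for v
  proof (rule connected_delete_vertex_ear[OF p(3)])
    show "p 0 \<in> verts ?W" "p n \<in> verts ?W"
      using p a b by (auto simp: union_graph_def)
    note del_AB = connected_delete_vertex_block[OF G(1) AB(1), of v]
      connected_delete_vertex_block[OF G(1) AB(2), of v]
    show "connected_graph (delete_vertex ?W v) \<or>
      v \<notin> p ` {..n} \<and>
      (\<forall>w\<in>verts (delete_vertex ?W v). \<exists>y\<in>{p 0, p n}. (w, y) \<in> (adjacency (delete_vertex ?W v))\<^sup>*)"
    \<comment> \<open>For \<open>v \<noteq> x\<close> both blocks survive as connected graphs that
      share \<open>x\<close>. For \<open>v = x\<close> they come apart into a piece containing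
      \<open>a\<close> and a piece containing \<open>b\<close>, and the path joins these
      ends.\<close>
    proof (cases "v = x")
      case False
      then have "x \<in> verts (delete_vertex A v) \<inter> verts (delete_vertex B v)"
        using x by (auto simp: delete_vertex_def)
      then have "connected_graph (delete_vertex ?W v)"
        unfolding delete_vertex_union_graph
        using del_AB by (intro connected_graph_union_pairwise) auto
      then show ?thesis ..
    next
      case True
      have "\<exists>y\<in>{p 0, p n}. (w, y) \<in> (adjacency (delete_vertex ?W v))\<^sup>*"
        if w: "w \<in> verts (delete_vertex ?W v)" for w
      proof -
        consider "w \<in> verts (delete_vertex A v)" | "w \<in> verts (delete_vertex B v)"
          using w by (auto simp: delete_vertex_def union_graph_def)
        then have "(w, a) \<in> (adjacency (delete_vertex A v))\<^sup>* \<or> (w, b) \<in> (adjacency (delete_vertex B v))\<^sup>*"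
          using del_AB True a b by cases (auto simp: connected_graph_def delete_vertex_def)
        then have "(w, a) \<in> (adjacency (delete_vertex ?W v))\<^sup>* \<or> (w, b) \<in> (adjacency (delete_vertex ?W v))\<^sup>*"
          unfolding delete_vertex_union_graph
          by (blast intro: adjacency_rtrancl_mono[OF _ edges_mem_union_graph])
        then show ?thesis using p by auto
      qed
      then show ?thesis using True xP by blast
    qed
  qed
  \<comment> \<open>If neither block has three vertices, both are bridges; being distinct edges,
    they have at least three ends together.\<close>
  have "3 \<le> card (verts A \<union> verts B)"
  proof (cases "3 \<le> card (verts A) \<or> 3 \<le> card (verts B)")
    case True
    moreover have "card (verts A) \<le> card (verts A \<union> verts B)" "card (verts B) \<le> card (verts A \<union> verts B)"
      by (auto intro!: card_mono)
    ultimately show ?thesis by linarith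
  next
    case False
    then obtain e f where ef: "A = (e, {e})" "B = (f, {f})"
      using AB(1,2) by (auto elim!: blockE simp: maximal_two_connected_subgraph_def two_connected_def)
    then have "e \<noteq> f" "card e = 2" "card f = 2"
      using sub AB(3) by (auto simp: subgraph_def simple_graph_def)
    then have "e \<subset> e \<union> f"
      by (metis Un_upper1 card_subset_eq finite psubsetI sup.absorb_iff1 Un_upper2)
    then show ?thesis
      using psubset_card_mono[of "e \<union> f" e] ef \<open>card e = 2\<close> by simp
  qed
  moreover have "verts A \<union> verts B \<subseteq> verts ?H"
    using H by (auto simp: subgraph_def)
  ultimately have "3 \<le> card (verts ?H)"
    using card_mono[of "verts ?H" "verts A \<union> verts B"] by simp
  then have tc: "two_connected ?H"
    using del by (rule two_connectedI)
  \<comment> \<open>A maximal 2-connected block inside \<open>?H\<close> equals \<open>?H\<close>,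
    and a bridge cannot be an edge of the 2-connected \<open>?H\<close>. Hence \<open>A\<close> and
    \<open>B\<close> coincide.\<close>
  have "D = ?H" if D: "D \<in> blocks G" "subgraph D ?H" for D
    using D(1)
  proof (cases rule: blockE)
    case 1
    then show ?thesis
      using D H tc unfolding maximal_two_connected_subgraph_def by blast
  next
    case (2 e)
    then have "e \<in> edges ?H" using D by (auto simp: subgraph_def)
    then show ?thesis
      using not_bridge_in_two_connected[OF G H(1) tc] 2 by blast
  qed
  then have "A = ?H" "B = ?H" using AB H by blast+
  then show False using AB(3) by simp
qed

section \<open>Adjacency of blocks\<close>

text \<open>This is connectivity of the block adjacency relation. Follow a walk from a vertex of a
  block in \<open>S\<close> to one of a block outside: every edge lies in some block, and if no
  block of \<open>S\<close> met one outside, the walk could never leave the blocks of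
  \<open>S\<close>.\<close>

lemma blocks_linked:
  fixes G :: "'a::finite ugraph"
  assumes G: "simple_graph G" "connected_graph G"
    and S: "S \<subseteq> blocks G" "S \<noteq> {}" "S \<noteq> blocks G"
  obtains A B where "A \<in> S" "B \<in> blocks G - S" "verts A \<inter> verts B \<noteq> {}"
proof (rule ccontr)
  note thesisI = that
  assume "\<not> thesis"
  then have no: "verts A \<inter> verts B = {}" if "A \<in> S" "B \<in> blocks G - S" for A B
    using that thesisI by blast
  obtain A B where AB: "A \<in> S" "B \<in> blocks G - S"
    using S by blast
  then obtain u w where uw: "u \<in> verts A" "w \<in> verts B"
    using verts_block_nonempty[OF G(1)] S(1) by blast
  then have "u \<in> verts G" "w \<in> verts G"
    using AB S(1) block_subgraph[OF G(1), of A] block_subgraph[OF G(1), of B]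
    by (auto simp: subgraph_def)
  then have "(u, w) \<in> (adjacency G)\<^sup>*"
    using G(2) by (simp add: connected_graph_def)
  then have "\<exists>D\<in>S. w \<in> verts D"
  proof induction
    case base
    show ?case using AB uw by blast
  next
    case (step y z)
    then obtain D where D: "D \<in> S" "y \<in> verts D" by blast
    have "{y, z} \<in> edges G" using step by (simp add: adjacency_def)
    then obtain E where E: "E \<in> blocks G" "{y, z} \<in> edges E"
      using edge_in_block[OF G] by blast
    then have "y \<in> verts E" "z \<in> verts E"
      using block_subgraph[OF G(1) E(1)] by (auto simp: subgraph_def simple_graph_def)
    then show ?case
      using no[of D E] D E by blast
  qed
  then show False
    using no[of _ B] AB uw by blast
qed

text \<open>The blocks meeting \<open>A\<close> form a set that contains \<open>A\<close> but not
  \<open>C\<close>, so some block \<open>B\<close> in it meets some block \<open>D\<close> outside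
  it.\<close>

lemma disjoint_blocks_induced_path:
  fixes G :: "'a::finite ugraph"
  assumes G: "simple_graph G" "connected_graph G"
    and AC: "A \<in> blocks G" "C \<in> blocks G" "verts A \<inter> verts C = {}"
  obtains B D where "B \<in> blocks G" "D \<in> blocks G" "verts A \<inter> verts B \<noteq> {}"
    "verts B \<inter> verts D \<noteq> {}" "verts A \<inter> verts D = {}"
proof -
  let ?S = "{B \<in> blocks G. verts A \<inter> verts B \<noteq> {}}"
  have "A \<in> ?S" using AC verts_block_nonempty[OF G(1)] by auto
  then obtain B D where BD: "B \<in> ?S" "D \<in> blocks G - ?S" "verts B \<inter> verts D \<noteq> {}"
    using blocks_linked[OF G, of ?S] AC by blast
  show ?thesis
    by (rule that[of B D]) (use BD in auto)
qed

section \<open>Cut vertices and pairwise intersecting blocks\<close>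

text \<open>Some vertex \<open>w\<close> is cut off from \<open>y\<close> by \<open>x\<close>. On a
  walk from \<open>w\<close> to \<open>x\<close>, the vertex \<open>w'\<close> just before the first
  arrival at \<open>x\<close> is still cut off from \<open>y\<close>. The block of the edge
  \<open>{w', x}\<close> stays connected without \<open>x\<close>, so all its other vertices lie on
  the side of \<open>w'\<close>.\<close>

lemma cut_vertex_block_off:
  fixes G :: "'a::finite ugraph"
  assumes G: "simple_graph G" "connected_graph G"
    and x: "cut_vertex G x" and y: "y \<noteq> x"
  obtains A where "A \<in> blocks G"
    "\<And>z. z \<in> verts A \<Longrightarrow> z = x \<or> (z, y) \<notin> (adjacency (delete_vertex G x))\<^sup>*"
proof -
  let ?R = "adjacency (delete_vertex G x)"
  have xG: "x \<in> verts G" "\<not> connected_graph (delete_vertex G x)"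
    using x G by (auto simp: cut_vertex_iff)
  then obtain w where w: "w \<in> verts G" "w \<noteq> x" "(w, y) \<notin> ?R\<^sup>*"
    using connected_graphI_hub[of "delete_vertex G x" y] by (auto simp: delete_vertex_def)
  then have "(w, x) \<in> (adjacency G)\<^sup>*"
    using G xG by (simp add: connected_graph_def)
  then have "\<exists>w'. w' \<noteq> x \<and> {w', x} \<in> edges G \<and> (w', y) \<notin> ?R\<^sup>*"
    using w(2,3)
  proof (induction rule: converse_rtrancl_induct)
    case (step u v)
    show ?case
    proof (cases "v = x")
      case True
      then show ?thesis using step by (auto simp: adjacency_def)
    next
      case False
      then have "(u, v) \<in> ?R"
        using step by (auto simp: adjacency_def delete_vertex_def)
      then have "(v, y) \<notin> ?R\<^sup>*"
        using step by (meson converse_rtrancl_into_rtrancl)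
      then show ?thesis using step False by blast
    qed
  qed simp
  then obtain w' where w': "w' \<noteq> x" "{w', x} \<in> edges G" "(w', y) \<notin> ?R\<^sup>*" by blast
  then obtain A where A: "A \<in> blocks G" "{w', x} \<in> edges A"
    using edge_in_block[OF G] by blast
  have sub: "subgraph A G"
    using block_subgraph[OF G(1) A(1)] .
  then have "w' \<in> verts A"
    using A(2) by (auto simp: subgraph_def simple_graph_def)
  have "(z, y) \<notin> ?R\<^sup>*" if "z \<in> verts A" "z \<noteq> x" for z
  proof
    assume zy: "(z, y) \<in> ?R\<^sup>*"
    have "(w', z) \<in> (adjacency (delete_vertex A x))\<^sup>*"
      using connected_delete_vertex_block[OF G(1) A(1), of x] that w' \<open>w' \<in> verts A\<close>
      by (auto simp: connected_graph_def delete_vertex_def)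
    then have "(w', z) \<in> ?R\<^sup>*"
      by (rule adjacency_rtrancl_mono) (use sub in \<open>auto simp: delete_vertex_def subgraph_def\<close>)
    then show False using zy w' by (meson rtrancl_trans)
  qed
  then show ?thesis using that A by blast
qed

text \<open>A walk from \<open>z\<close> cannot meet \<open>y\<close> before it first arrives at
  \<open>x\<close>, for otherwise it would join \<open>z\<close> to \<open>y\<close> without
  \<open>x\<close>.\<close>

lemma separated_reaches_separator:
  assumes "(z, x) \<in> (adjacency G)\<^sup>*" "z \<noteq> x" "x \<noteq> y"
    and "(z, y) \<notin> (adjacency (delete_vertex G x))\<^sup>*"
  shows "(z, x) \<in> (adjacency (delete_vertex G y))\<^sup>*"
  using assms(1,2,4)
proof (induction rule: converse_rtrancl_induct)
  case (step u v)
  have "u \<noteq> y" using step.prems by auto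
  show ?case
  proof (cases "v = x")
    case True
    then show ?thesis
      using step \<open>u \<noteq> y\<close> assms(3) by (auto simp: adjacency_def delete_vertex_def)
  next
    case False
    then have "(u, v) \<in> adjacency (delete_vertex G x)"
      using step by (auto simp: adjacency_def delete_vertex_def)
    then have vy: "(v, y) \<notin> (adjacency (delete_vertex G x))\<^sup>*"
      using step by (meson converse_rtrancl_into_rtrancl)
    then have "v \<noteq> y" by auto
    then have "(u, v) \<in> adjacency (delete_vertex G y)"
      using step \<open>u \<noteq> y\<close> by (auto simp: adjacency_def delete_vertex_def)
    then show ?thesis
      using step.IH[OF False vy] by (rule converse_rtrancl_into_rtrancl)
  qed
qed simp

text \<open>Two disjoint blocks yield an induced path \<open>A\<close>, \<open>B\<close>,
  \<open>D\<close>; common vertices of \<open>A\<close>, \<open>B\<close> and of \<open>B\<close>,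
  \<open>D\<close> are two distinct cut vertices. Conversely, for cut vertices
  \<open>x \<noteq> y\<close>, take a block beyond \<open>x\<close> as seen from \<open>y\<close>
  and one beyond \<open>y\<close> as seen from \<open>x\<close>. A common vertex \<open>z\<close>
  would be separated from \<open>y\<close> by \<open>x\<close>, hence reach \<open>x\<close> without
  \<open>y\<close>, against the choice of the second block.\<close>

lemma card_cut_vertices_le_1_iff:
  fixes G :: "'a::finite ugraph"
  assumes G: "simple_graph G" "connected_graph G"
  shows "card {v. cut_vertex G v} \<le> 1 \<longleftrightarrow>
    (\<forall>A\<in>blocks G. \<forall>B\<in>blocks G. verts A \<inter> verts B \<noteq> {})"
proof
  assume "card {v. cut_vertex G v} \<le> 1"
  then have one: "u = v" if "cut_vertex G u" "cut_vertex G v" for u v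
    using that by (auto simp: card_le_Suc0_iff_eq)
  show "\<forall>A\<in>blocks G. \<forall>B\<in>blocks G. verts A \<inter> verts B \<noteq> {}"
  proof (rule ccontr)
    assume "\<not> ?thesis"
    then obtain A C where AC: "A \<in> blocks G" "C \<in> blocks G" "verts A \<inter> verts C = {}" by blast
    then obtain B D where BD: "B \<in> blocks G" "D \<in> blocks G" "verts A \<inter> verts B \<noteq> {}"
      "verts B \<inter> verts D \<noteq> {}" "verts A \<inter> verts D = {}"
      using disjoint_blocks_induced_path[OF G] by blast
    then obtain x y where xy: "x \<in> verts A" "x \<in> verts B" "y \<in> verts B" "y \<in> verts D" by blast
    moreover have "A \<noteq> B" "B \<noteq> D" using BD by auto
    ultimately have "cut_vertex G x" "cut_vertex G y"
      using common_vertex_of_blocks_is_cut_vertex[OF G] AC BD by blast+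
    then show False using one xy BD by blast
  qed
next
  assume pw: "\<forall>A\<in>blocks G. \<forall>B\<in>blocks G. verts A \<inter> verts B \<noteq> {}"
  have "x = y" if xy: "cut_vertex G x" "cut_vertex G y" for x y
  proof (rule ccontr)
    assume "x \<noteq> y"
    obtain A where A: "A \<in> blocks G"
      "\<And>z. z \<in> verts A \<Longrightarrow> z = x \<or> (z, y) \<notin> (adjacency (delete_vertex G x))\<^sup>*"
      using cut_vertex_block_off[OF G xy(1), of y] \<open>x \<noteq> y\<close> by metis
    obtain C where C: "C \<in> blocks G"
      "\<And>z. z \<in> verts C \<Longrightarrow> z = y \<or> (z, x) \<notin> (adjacency (delete_vertex G y))\<^sup>*"
      using cut_vertex_block_off[OF G xy(2), of x] \<open>x \<noteq> y\<close> by metis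
    obtain z where z: "z \<in> verts A" "z \<in> verts C" using pw A C by blast
    \<comment> \<open>Each of \<open>x\<close> and \<open>y\<close> reaches itself, so the block
      beyond \<open>y\<close> does not contain \<open>x\<close>, and the block beyond
      \<open>x\<close> does not contain \<open>y\<close>.\<close>
    have "z \<noteq> x" "z \<noteq> y"
      using A(2)[OF z(1)] C(2)[OF z(2)] \<open>x \<noteq> y\<close> by auto
    have "z \<in> verts G" "x \<in> verts G"
      using block_subgraph[OF G(1) A(1)] z xy by (auto simp: subgraph_def cut_vertex_def)
    then have "(z, x) \<in> (adjacency G)\<^sup>*" using G by (simp add: connected_graph_def)
    then show False
      using separated_reaches_separator[of z x G y] A(2) C(2) z \<open>z \<noteq> x\<close> \<open>z \<noteq> y\<close> \<open>x \<noteq> y\<close> by blast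
  qed
  then show "card {v. cut_vertex G v} \<le> 1" by (auto simp: card_le_Suc0_iff_eq)
qed

section \<open>Polytopes spanned by 0/1 vectors\<close>

text \<open>The index type is arbitrary, which keeps the polytope arguments free of graphs;
  \<open>incidence_vector\<close> is the instance for blocks.\<close>

definition char_vec :: "'i::finite set \<Rightarrow> real ^ 'i" where
  "char_vec S = (\<chi> i. if i \<in> S then 1 else 0)"

text \<open>Linear functionals thus become weights on the indices, and faces are found by maximising
  the weight of a set.\<close>

lemma inner_char_vec:
  fixes w :: "'i::finite \<Rightarrow> real"
  shows "(\<chi> B. w B) \<bullet> char_vec S = sum w S"
proof -
  have "(\<chi> B. w B) \<bullet> char_vec S = (\<Sum>B\<in>UNIV. if B \<in> S then w B else 0)"
    by (auto simp: inner_vec_def char_vec_def intro: sum.cong)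
  also have "\<dots> = sum w S"
    by (simp add: sum.If_cases)
  finally show ?thesis .
qed

lemma inj_char_vec: "inj char_vec"
proof (rule injI)
  fix S T :: "'i::finite set"
  assume "char_vec S = char_vec T"
  then have "char_vec S $ B = char_vec T $ B" for B
    by simp
  then have "(B \<in> S) = (B \<in> T)" for B
    unfolding char_vec_def vec_lambda_beta by (metis zero_neq_one)
  then show "S = T" by blast
qed

lemma char_vec_eq_iff [simp]:
  "char_vec S = char_vec T \<longleftrightarrow> S = T"
  using inj_char_vec by (auto dest: injD)

lemma char_vec_empty: "char_vec {} = 0"
  by (simp add: char_vec_def vec_eq_iff)

lemma char_vec_add:
  "S \<inter> T = {} \<Longrightarrow> char_vec (S \<union> T) = char_vec S + char_vec T"
  by (auto simp: char_vec_def vec_eq_iff)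

lemma polytope_char_hull: "polytope (convex hull (char_vec ` F))"
  by (simp add: polytope_convex_hull)

text \<open>The weight bound is a valid inequality, so equality in it cuts out a face. That face is
  the hull of the generators it contains, which are those of weight exactly
  \<open>m\<close>.\<close>

lemma face_of_char_hull:
  fixes F :: "'i::finite set set" and w :: "'i \<Rightarrow> real"
  assumes "\<And>S. S \<in> F \<Longrightarrow> sum w S \<le> m"
  shows "convex hull (char_vec ` {S \<in> F. sum w S = m}) face_of
    convex hull (char_vec ` F)"
proof -
  let ?P = "convex hull (char_vec ` F)"
  let ?w = "\<chi> B. w B"
  have "?P \<subseteq> {x. ?w \<bullet> x \<le> m}"
    using assms by (intro hull_minimal convex_halfspace_le) (auto simp: inner_char_vec)
  then have face: "?P \<inter> {x. ?w \<bullet> x = m} face_of ?P"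
    by (intro face_of_Int_supporting_hyperplane_le) auto
  have "compact (char_vec ` F)"
    by (intro finite_imp_compact finite_imageI finite)
  then obtain S' where S': "S' \<subseteq> char_vec ` F" "?P \<inter> {x. ?w \<bullet> x = m} = convex hull S'"
    using face by (rule face_of_convex_hull_subset)
  have "S' \<subseteq> char_vec ` {S \<in> F. sum w S = m}"
  proof
    fix x assume x: "x \<in> S'"
    then have "?w \<bullet> x = m"
      using S'(2) hull_inc[of x S' convex] by blast
    moreover obtain S where "S \<in> F" "x = char_vec S"
      using S'(1) x by blast
    ultimately show "x \<in> char_vec ` {S \<in> F. sum w S = m}"
      by (simp add: inner_char_vec)
  qed
  then have "?P \<inter> {x. ?w \<bullet> x = m} \<subseteq> convex hull (char_vec ` {S \<in> F. sum w S = m})"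
    unfolding S'(2) by (rule hull_mono)
  moreover have "convex hull (char_vec ` {S \<in> F. sum w S = m}) \<subseteq> ?P \<inter> {x. ?w \<bullet> x = m}"
    by (intro hull_minimal convex_Int convex_convex_hull convex_hyperplane)
      (auto simp: inner_char_vec intro: hull_inc)
  ultimately have "?P \<inter> {x. ?w \<bullet> x = m} = convex hull (char_vec ` {S \<in> F. sum w S = m})"
    by (rule subset_antisym)
  then show ?thesis
    using face by metis
qed

text \<open>The coordinates outside \<open>K\<close> are frozen to their values in \<open>S\<close>.
  Weight 0 on \<open>K\<close>, 1 on the rest of \<open>S\<close> and -1 elsewhere has maximum
  \<open>card (S - K)\<close>, attained exactly by the sets that agree with \<open>S\<close> outside
  \<open>K\<close>.\<close>

lemma subcube_face_of_char_hull:
  fixes F :: "'i::finite set set"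
  shows "convex hull (char_vec ` {T \<in> F. T - K = S - K}) face_of
    convex hull (char_vec ` F)"
proof -
  define w :: "'i \<Rightarrow> real" where
    "w B = (if B \<in> K then 0 else if B \<in> S then 1 else -1)" for B
  have w: "sum w T = real (card (T \<inter> (S - K))) - real (card (T - S - K))" for T
  proof -
    have "sum w T = sum w (T \<inter> K) + (sum w (T \<inter> (S - K)) + sum w (T - S - K))"
      by (subst sum.union_disjoint[symmetric], (auto)[3])+ (rule arg_cong[of _ _ "sum w"], blast)
    also have "sum w (T \<inter> K) = 0"
      by (intro sum.neutral) (simp add: w_def)
    also have "sum w (T \<inter> (S - K)) = sum (\<lambda>_. 1) (T \<inter> (S - K))"
      by (intro sum.cong) (auto simp: w_def)
    also have "sum w (T - S - K) = sum (\<lambda>_. -1) (T - S - K)"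
      by (intro sum.cong) (auto simp: w_def)
    finally show ?thesis by simp
  qed
  have card: "card (T \<inter> (S - K)) \<le> card (S - K)" for T
    by (intro card_mono) auto
  have "sum w T = card (S - K) \<longleftrightarrow> T - K = S - K" for T
  proof
    assume "sum w T = card (S - K)"
    then have "card (T \<inter> (S - K)) = card (S - K)" "card (T - S - K) = 0"
      using card[of T] unfolding w by linarith+
    then have "T \<inter> (S - K) = S - K" "T - S - K = {}"
      by (simp_all add: card_subset_eq)
    then show "T - K = S - K" by blast
  next
    assume "T - K = S - K"
    then have "T \<inter> (S - K) = S - K" "T - S - K = {}" by blast+
    then show "sum w T = card (S - K)" by (simp add: w)
  qed
  moreover have "sum w T \<le> card (S - K)" for T
    using card[of T] by (simp add: w)
  ultimately show ?thesis
    using face_of_char_hull[of F w "card (S - K)"] by simp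
qed

text \<open>With no coordinate left free, a subcube face is a single point; hence each generator is
  a vertex.\<close>

lemma extreme_point_of_char_hull:
  fixes F :: "'i::finite set set"
  shows "x extreme_point_of convex hull (char_vec ` F) \<longleftrightarrow> x \<in> char_vec ` F"
proof
  assume "x \<in> char_vec ` F"
  then obtain S where S: "S \<in> F" "x = char_vec S" by blast
  then have "{T \<in> F. T - {} = S - {}} = {S}" by auto
  then have "{x} face_of convex hull (char_vec ` F)"
    using subcube_face_of_char_hull[of F "{}" S] S by simp
  then show "x extreme_point_of convex hull (char_vec ` F)"
    by (simp add: face_of_singleton)
qed (rule extreme_point_of_convex_hull)

section \<open>Edges and dimension of 0/1 polytopes\<close>

lemma edge_of_char_hull:
  fixes F :: "'i::finite set set" and w :: "'i \<Rightarrow> real"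
  assumes ST: "S \<in> F" "T \<in> F" "S \<noteq> T" "sum w S = m" "sum w T = m"
    and less: "\<And>R. R \<in> F \<Longrightarrow> R \<noteq> S \<Longrightarrow> R \<noteq> T \<Longrightarrow> sum w R < m"
  shows "closed_segment (char_vec S) (char_vec T) edge_of
    convex hull (char_vec ` F)"
proof -
  have "sum w R \<le> m" if "R \<in> F" for R
    using ST less[OF that] by (cases "R = S \<or> R = T") auto
  then have "convex hull (char_vec ` {R \<in> F. sum w R = m}) face_of convex hull (char_vec ` F)"
    by (rule face_of_char_hull)
  moreover have "{R \<in> F. sum w R = m} = {S, T}"
  proof (rule set_eqI)
    fix R
    show "R \<in> {R \<in> F. sum w R = m} \<longleftrightarrow> R \<in> {S, T}"
      using ST less[of R] by (cases "R = S \<or> R = T") auto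
  qed
  ultimately show ?thesis
    using \<open>S \<noteq> T\<close> by (simp add: edge_of_def segment_convex_hull aff_dim_convex_hull aff_dim_2)
qed

text \<open>Covers the edges for which freezing coordinates leaves only two generators, so that no
  explicit weight has to be chosen.\<close>

lemma subcube_edge_of_char_hull:
  fixes F :: "'i::finite set set"
  assumes "{T \<in> F. T - K = S - K} = {S, T}" "S \<noteq> T"
  shows "closed_segment (char_vec S) (char_vec T) edge_of
    convex hull (char_vec ` F)"
  using subcube_face_of_char_hull[of F K S] assms
  by (simp add: edge_of_def segment_convex_hull aff_dim_convex_hull aff_dim_2)

text \<open>An edge is compact, convex and collinear, hence a segment. Its end points are extreme
  points of the polytope and therefore generators, one of them being the given vertex.\<close>

lemma edge_of_char_hullE:
  fixes F :: "'i::finite set set"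
  assumes e: "e edge_of convex hull (char_vec ` F)" and S: "char_vec S \<in> e" "S \<in> F"
  obtains T where "T \<in> F" "T \<noteq> S" "e = closed_segment (char_vec S) (char_vec T)"
proof -
  let ?P = "convex hull (char_vec ` F)"
  have face: "e face_of ?P" and dim: "aff_dim e = 1"
    using e by (auto simp: edge_of_def)
  have "compact ?P"
    by (intro finite_imp_compact_convex_hull finite_imageI finite)
  then have "compact e" "convex e"
    using face face_of_imp_compact face_of_imp_convex convex_convex_hull by blast+
  moreover have "collinear e" "e \<noteq> {}"
    using dim by (auto simp: collinear_aff_dim)
  ultimately obtain a b where ab: "e = closed_segment a b"
    by (metis compact_convex_collinear_segment)
  have ext: "x extreme_point_of e \<longleftrightarrow> x \<in> char_vec ` F \<and> x \<in> e" for x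
    using extreme_point_of_face[OF face] extreme_point_of_char_hull by blast
  have "a \<noteq> b" using ab dim by auto
  have "char_vec S = a \<or> char_vec S = b"
    using ext[of "char_vec S"] S by (simp add: ab extreme_point_of_segment)
  then obtain c where c: "e = closed_segment (char_vec S) c" "c \<noteq> char_vec S"
    using ab \<open>a \<noteq> b\<close> closed_segment_commute by metis
  then obtain T where "c = char_vec T" "T \<in> F"
    using ext[of c] by (auto simp: extreme_point_of_segment)
  then show ?thesis
    using that c by blast
qed

text \<open>The hull contains 0, so its affine dimension is the linear one. The singletons supply
  the unit vectors of \<open>K\<close>, which span every vector supported on
  \<open>K\<close>.\<close>

lemma aff_dim_char_hull:
  fixes F :: "'i::finite set set"
  assumes "\<And>S. S \<in> F \<Longrightarrow> S \<subseteq> K" "{} \<in> F" "\<And>B. B \<in> K \<Longrightarrow> {B} \<in> F"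
  shows "aff_dim (convex hull (char_vec ` F)) = card K"
proof -
  have ax: "char_vec {B} = axis B 1" for B :: "'i"
    by (auto simp: char_vec_def axis_def vec_eq_iff)
  let ?E = "(\<lambda>B. axis B (1::real)) ` K"
  have "dim (char_vec ` F) = card K"
  proof (rule dim_unique)
    show "?E \<subseteq> char_vec ` F"
      using assms(3) by (auto simp: ax[symmetric])
    show "char_vec ` F \<subseteq> span ?E"
    proof clarify
      fix S assume S: "S \<in> F"
      have "char_vec S = (\<Sum>B\<in>S. axis B 1)"
      proof (unfold vec_eq_iff, rule allI)
        fix C
        have "(\<Sum>B\<in>S. axis B 1) $ C = (\<Sum>B\<in>S. if C = B then 1 else 0)"
          unfolding sum_component by (intro sum.cong) (simp_all add: axis_def)
        also have "\<dots> = char_vec S $ C"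
          by (simp add: char_vec_def)
        finally show "char_vec S $ C = (\<Sum>B\<in>S. axis B 1) $ C" ..
      qed
      also have "\<dots> \<in> span ?E"
        using assms(1)[OF S] by (intro span_sum span_base) auto
      finally show "char_vec S \<in> span ?E" .
    qed
    show "independent ?E"
      by (rule independent_mono[OF independent_Basis]) (auto simp: axis_in_Basis_iff)
    show "card ?E = card K"
      by (intro card_image inj_onI) (simp add: axis_eq_axis)
  qed
  moreover have "0 \<in> affine hull (char_vec ` F)"
    using assms(2) by (intro hull_inc) (auto simp: char_vec_empty[symmetric])
  ultimately show ?thesis
    by (simp add: aff_dim_convex_hull aff_dim_zero)
qed

section \<open>Simplicity: the cube, and a criterion for failure\<close>

text \<open>The edges at the vertex of \<open>S\<close> correspond to the elements of
  \<open>K\<close>: each of them joins \<open>S\<close> to the set obtained by flipping one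
  element.\<close>

lemma simple_polytope_cube:
  fixes K :: "'i::finite set"
  shows "simple_polytope (convex hull (char_vec ` Pow K))"
  unfolding simple_polytope_def
proof (intro conjI polytope_char_hull allI impI)
  let ?P = "convex hull (char_vec ` Pow K)"
  have dim: "aff_dim ?P = card K"
    by (rule aff_dim_char_hull) auto
  fix x assume "x extreme_point_of ?P"
  then obtain S where S: "S \<subseteq> K" "x = char_vec S"
    by (auto simp: extreme_point_of_char_hull)
  define flip where "flip B = (if B \<in> S then S - {B} else insert B S)" for B
  define seg where "seg B = closed_segment (char_vec S) (char_vec (flip B))" for B
  have flip: "flip B \<noteq> S" "flip B - {B} = S - {B}" "B \<in> K \<Longrightarrow> flip B \<subseteq> K" for B
    using S by (auto simp: flip_def)
  have "{e. e edge_of ?P \<and> x \<in> e} = seg ` K"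
  proof
    show "seg ` K \<subseteq> {e. e edge_of ?P \<and> x \<in> e}"
    proof clarify
      fix B assume B: "B \<in> K"
      have "{T \<in> Pow K. T - {B} = S - {B}} = {S, flip B}"
        using S B by (auto simp: flip_def)
      then have "seg B edge_of ?P"
        unfolding seg_def using flip(1)[of B] by (intro subcube_edge_of_char_hull[of _ "{B}"]) auto
      then show "seg B edge_of ?P \<and> x \<in> seg B"
        by (simp add: seg_def S)
    qed
    show "{e. e edge_of ?P \<and> x \<in> e} \<subseteq> seg ` K"
    proof clarify
      fix e assume e: "e edge_of ?P" "x \<in> e"
      then obtain T where T: "T \<subseteq> K" "T \<noteq> S"
        "e = closed_segment (char_vec S) (char_vec T)"
        using S by (auto elim: edge_of_char_hullE)
      then obtain B where B: "B \<in> K" "(B \<in> S) \<noteq> (B \<in> T)"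
        using S by blast
      define T' where "T' = (if B \<in> T then T - {B} else insert B T)"
      have "T' \<subseteq> K" using T B by (auto simp: T'_def)
      text \<open>The segments from \<open>S\<close> to \<open>T\<close> and from \<open>flip B\<close> to \<open>T'\<close> have the same midpoint,
        so the face \<open>e\<close> contains the latter segment as well.\<close>
      have sum: "char_vec S + char_vec T = char_vec (flip B) + char_vec T'"
        using B by (auto simp: vec_eq_iff char_vec_def flip_def T'_def)
      have "flip B = T"
      proof (rule ccontr)
        assume "flip B \<noteq> T"
        have face: "e face_of ?P" using e by (simp add: edge_of_def)
        have "flip B \<noteq> T'"
          using B by (auto simp: flip_def T'_def)
        then have "midpoint (char_vec (flip B)) (char_vec T') \<in>
          open_segment (char_vec (flip B)) (char_vec T')"
          by simp
        moreover have "midpoint (char_vec (flip B)) (char_vec T') \<in> e"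
        proof -
          have "midpoint (char_vec (flip B)) (char_vec T') =
            midpoint (char_vec S) (char_vec T)"
            using sum by (simp add: midpoint_def)
          then show ?thesis using T by simp
        qed
        moreover have "char_vec (flip B) \<in> ?P" "char_vec T' \<in> ?P"
          using flip(3) B \<open>T' \<subseteq> K\<close> by (auto intro!: hull_inc)
        ultimately have "char_vec (flip B) \<in> e"
          using face by (meson face_ofD)
        moreover have "char_vec (flip B) extreme_point_of ?P"
          using flip(3) B by (simp add: extreme_point_of_char_hull)
        ultimately have "char_vec (flip B) extreme_point_of e"
          using extreme_point_of_face[OF face] by blast
        then show False
          using flip(1) \<open>flip B \<noteq> T\<close> by (simp add: T extreme_point_of_segment)
      qed
      then show "e \<in> seg ` K" using T B by (auto simp: seg_def)
    qed
  qed
  moreover have "inj_on seg K"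
  proof (rule inj_onI)
    fix B C assume "seg B = seg C"
    then have "flip B = flip C"
      using flip(1) by (auto simp: seg_def doubleton_eq_iff)
    then show "B = C" by (auto simp: flip_def split: if_splits)
  qed
  ultimately show "int (card {e. e edge_of ?P \<and> x \<in> e}) = aff_dim ?P"
    by (simp add: dim card_image)
qed

text \<open>The vertex of \<open>{A}\<close> has one neighbour \<open>nb D\<close> for each
  \<open>D\<close> in \<open>K\<close>, where \<open>nb A = {}\<close>, and the further neighbour
  \<open>{A, B, C}\<close>. The absence of \<open>{A, C}\<close> makes the last segment an edge;
  otherwise it would be a diagonal of the square on \<open>{A}\<close>, \<open>{A, B}\<close>,
  \<open>{A, C}\<close>, \<open>{A, B, C}\<close>.\<close>

lemma not_simple_char_hull:
  fixes F :: "'i::finite set set"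
  assumes F: "\<And>S. S \<in> F \<Longrightarrow> S \<subseteq> K" "{} \<in> F" "\<And>D. D \<in> K \<Longrightarrow> {D} \<in> F"
    and AC: "A \<in> K" "C \<in> K" "A \<noteq> B" "B \<noteq> C" "A \<noteq> C"
    and ABC: "{A, B} \<in> F" "{A, C} \<notin> F" "{A, B, C} \<in> F"
  shows "\<not> simple_polytope (convex hull (char_vec ` F))"
proof -
  let ?P = "convex hull (char_vec ` F)"
  define seg where "seg T = closed_segment (char_vec {A}) (char_vec T)" for T
  define nb where "nb D = (if D = A then {} else if {A, D} \<in> F then {A, D} else {D})" for D
  have "{A} \<in> F"
    using F AC by blast
  then have "seg {} edge_of ?P"
    unfolding seg_def using F AC by (intro subcube_edge_of_char_hull[of _ "{A}"]) auto
  moreover have "seg {A, D} edge_of ?P" if "D \<noteq> A" "{A, D} \<in> F" for D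
    unfolding seg_def using F AC that \<open>{A} \<in> F\<close> by (intro subcube_edge_of_char_hull[of _ "{D}"]) auto
  moreover have "seg {D} edge_of ?P" if D: "D \<in> K" "D \<noteq> A" "{A, D} \<notin> F" for D
  proof -
    \<comment> \<open>Only \<open>{A, D}\<close> could have weight above 1, and it is not in
      \<open>F\<close>; any further element costs 2, which brings the weight down to at most
      0.\<close>
    define w :: "'i \<Rightarrow> real" where "w E = (if E = A \<or> E = D then 1 else -2)" for E
    have w: "sum w S = of_bool (A \<in> S) + of_bool (D \<in> S) - 2 * real (card (S - {A, D}))" for S
    proof -
      have "sum w S = sum w (S \<inter> {A, D}) + sum w (S - {A, D})"
        by (intro sum.Int_Diff) simp
      also have "sum w (S \<inter> {A, D}) = of_bool (A \<in> S) + of_bool (D \<in> S)"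
        using D by (cases "A \<in> S"; cases "D \<in> S") (auto simp: w_def)
      also have "sum w (S - {A, D}) = sum (\<lambda>_. -2) (S - {A, D})"
        by (intro sum.cong) (auto simp: w_def)
      finally show ?thesis by simp
    qed
    have neg: "sum w S < 1" if "S \<in> F" "S \<noteq> {A}" "S \<noteq> {D}" for S
    proof (cases "S - {A, D} = {}")
      case True
      moreover have "S \<noteq> {A, D}" using that D by blast
      ultimately have "S = {}" using that by blast
      then show ?thesis by simp
    next
      case False
      then have "0 < card (S - {A, D})" by (simp add: card_gt_0_iff)
      then have "1 \<le> real (card (S - {A, D}))" by linarith
      moreover have "of_bool (A \<in> S) \<le> (1::real)" "of_bool (D \<in> S) \<le> (1::real)"
        by simp_all
      ultimately show ?thesis unfolding w by linarith
    qed
    have one: "sum w {A} = 1" "sum w {D} = 1"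
      by (auto simp: w_def)
    show ?thesis
      unfolding seg_def
    proof (rule edge_of_char_hull)
      show "{D} \<in> F" "{A} \<noteq> {D}"
        using F D by auto
    qed (fact neg one \<open>{A} \<in> F\<close>)+
  qed
  moreover have "seg {A, B, C} edge_of ?P"
  proof -
    \<comment> \<open>Both \<open>{A}\<close> and \<open>{A, B, C}\<close> have weight 2. Among the
      subsets of \<open>{A, B, C}\<close> only the missing \<open>{A, C}\<close> exceeds this, with
      weight 3; any element outside costs 3 and leaves at most 0.\<close>
    define w :: "'i \<Rightarrow> real" where
      "w E = (if E = A then 2 else if E = B then -1 else if E = C then 1 else -3)" for E
    have w: "sum w S = 2 * of_bool (A \<in> S) - of_bool (B \<in> S) + of_bool (C \<in> S) - 3 * real (card (S - {A, B, C}))" for S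
    proof -
      have "sum w S = sum w (S \<inter> {A, B, C}) + sum w (S - {A, B, C})"
        by (intro sum.Int_Diff) simp
      also have "sum w (S \<inter> {A, B, C}) = 2 * of_bool (A \<in> S) - of_bool (B \<in> S) + of_bool (C \<in> S)"
        using AC by (cases "A \<in> S"; cases "B \<in> S"; cases "C \<in> S") (auto simp: w_def)
      also have "sum w (S - {A, B, C}) = sum (\<lambda>_. -3) (S - {A, B, C})"
        by (intro sum.cong) (auto simp: w_def)
      finally show ?thesis by simp
    qed
    have neg: "sum w S < 2" if S: "S \<in> F" "S \<noteq> {A}" "S \<noteq> {A, B, C}" for S
    proof (cases "S - {A, B, C} = {}")
      case True
      have "S \<noteq> {A, C}" using S ABC by blast
      then have "\<not> (A \<in> S \<and> (B \<notin> S \<or> C \<in> S))"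
        using True S by blast
      then show ?thesis using True by (auto simp: w)
    next
      case False
      then have "0 < card (S - {A, B, C})" by (simp add: card_gt_0_iff)
      then have "1 \<le> real (card (S - {A, B, C}))" by linarith
      moreover have "of_bool (A \<in> S) \<le> (1::real)" "0 \<le> (of_bool (B \<in> S) :: real)"
        "of_bool (C \<in> S) \<le> (1::real)"
        by simp_all
      ultimately show ?thesis unfolding w by linarith
    qed
    have two: "sum w {A} = 2" "sum w {A, B, C} = 2"
      using AC by (auto simp: w_def)
    show ?thesis
      unfolding seg_def
    proof (rule edge_of_char_hull)
      show "{A} \<noteq> {A, B, C}"
        using AC by blast
    qed (fact neg two ABC \<open>{A} \<in> F\<close>)+
  qed
  ultimately have edges: "seg ` (insert {A, B, C} (nb ` K)) \<subseteq> {e. e edge_of ?P \<and> char_vec {A} \<in> e}"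
    by (auto simp: nb_def seg_def)
  have "inj seg"
    by (auto simp: seg_def doubleton_eq_iff intro!: injI)
  have "inj_on nb K"
    by (auto simp: nb_def inj_on_def doubleton_eq_iff split: if_splits)
  moreover have "{A, B, C} \<notin> nb ` K"
  proof
    assume "{A, B, C} \<in> nb ` K"
    then obtain D where "{A, B, C} = nb D" by blast
    moreover have "nb D \<subseteq> {A, D}"
      by (auto simp: nb_def)
    ultimately have "{A, B, C} \<subseteq> {A, D}" by simp
    then show False using AC by blast
  qed
  ultimately have "card (insert {A, B, C} (nb ` K)) = Suc (card K)"
    by (simp add: card_image)
  then have "card (seg ` (insert {A, B, C} (nb ` K))) = Suc (card K)"
    using \<open>inj seg\<close> by (metis card_image inj_on_subset subset_UNIV)
  \<comment> \<open>The cardinality of an infinite set is 0 by convention, so the lower bound needs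
    finiteness.\<close>
  moreover have "finite {e. e edge_of ?P \<and> char_vec {A} \<in> e}"
    using finite_polytope_faces[OF polytope_char_hull[of F]]
    by (rule rev_finite_subset) (auto simp: edge_of_def)
  ultimately have "Suc (card K) \<le> card {e. e edge_of ?P \<and> char_vec {A} \<in> e}"
    using edges by (metis card_mono)
  moreover have "aff_dim ?P = card K"
    using F by (rule aff_dim_char_hull)
  moreover have "char_vec {A} extreme_point_of ?P"
    using F AC by (auto simp: extreme_point_of_char_hull)
  ultimately show ?thesis
    unfolding simple_polytope_def by fastforce
qed

section \<open>Simpliciality: low dimension, and square faces\<close>

text \<open>Proper faces have smaller dimension, hence at most 1, and polytopes of dimension at most
  1 are simplices.\<close>

lemma simplicial_polytope_aff_dim_le_2:
  assumes "polytope P" "aff_dim P \<le> 2"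
  shows "simplicial_polytope P"
  unfolding simplicial_polytope_def
proof (intro conjI allI impI)
  fix F assume F: "F face_of P \<and> F \<noteq> P"
  then have "aff_dim F < aff_dim P"
    using assms by (intro face_of_aff_dim_lt) (auto intro: polytope_imp_convex)
  moreover have "polytope F"
    using F assms face_of_polytope_polytope by blast
  moreover from calculation have "aff_dim F \<le> 1"
    using assms(2) by linarith
  ultimately show "\<exists>n. n simplex F"
    using polytope_lowdim_imp_simplex by metis
qed (rule assms)

text \<open>The subsets of \<open>{A, B}\<close> span a square face, which is proper since it misses
  the vertex of \<open>{C}\<close>. A square is not a simplex, because one corner is an affine
  combination of the other three.\<close>

lemma not_simplicial_char_hull:
  fixes F :: "'i::finite set set"
  assumes F: "{} \<in> F" "{A} \<in> F" "{B} \<in> F" "{A, B} \<in> F" "{C} \<in> F"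
    and ABC: "A \<noteq> B" "A \<noteq> C" "B \<noteq> C"
  shows "\<not> simplicial_polytope (convex hull (char_vec ` F))"
proof
  let ?P = "convex hull (char_vec ` F)"
  \<comment> \<open>These are the members of \<open>F\<close> contained in \<open>{A, B}\<close>,
    written as a subcube around \<open>{}\<close>.\<close>
  let ?F = "{T \<in> F. T - {A, B} = {} - {A, B}}"
  let ?Q = "convex hull (char_vec ` ?F)"
  assume "simplicial_polytope ?P"
  moreover have "?Q face_of ?P"
    by (rule subcube_face_of_char_hull)
  moreover have "?Q \<noteq> ?P"
  proof
    assume eq: "?Q = ?P"
    have "char_vec {C} extreme_point_of ?P"
      unfolding extreme_point_of_char_hull using F(5) by blast
    then have "char_vec {C} \<in> char_vec ` ?F"
      unfolding eq[symmetric] by (rule extreme_point_of_convex_hull)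
    then show False using ABC by auto
  qed
  ultimately obtain n where "n simplex ?Q"
    unfolding simplicial_polytope_def by blast
  then obtain D where D: "\<not> affine_dependent D" "?Q = convex hull D"
    by (auto simp: simplex_def)
  \<comment> \<open>Both sides are the set of extreme points of \<open>?Q\<close>.\<close>
  then have D_eq: "D = char_vec ` ?F"
    using extreme_point_of_char_hull[of _ ?F] extreme_point_of_convex_hull_affine_independent[OF D(1)]
    unfolding D(2) by blast
  let ?v = "char_vec {A, B}"
  have in_D: "char_vec S \<in> D - {?v}" if "S \<in> {{}, {A}, {B}}" for S
    using that F ABC by (auto simp: D_eq doubleton_eq_iff)
  have "char_vec {A} + 1 *\<^sub>R (char_vec {B} - char_vec {}) \<in> affine hull (D - {?v})"
    using in_D by (intro mem_affine_3_minus affine_affine_hull hull_inc) auto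
  also have "char_vec {A} + 1 *\<^sub>R (char_vec {B} - char_vec {}) = ?v"
    using char_vec_add[of "{A}" "{B}"] ABC by (simp add: char_vec_empty insert_commute)
  finally have "?v \<in> affine hull (D - {?v})" .
  moreover have "?v \<in> D" using F by (auto simp: D_eq)
  ultimately show False
    using D(1) by (auto simp: affine_dependent_def)
qed

section \<open>The connected blocks polytope\<close>

lemma incidence_vector_eq_char_vec: "incidence_vector = char_vec"
  by (simp add: fun_eq_iff incidence_vector_def char_vec_def)

theorem proposition4p2:
  fixes G :: "'a::finite ugraph"
  assumes "simple_graph G" and "connected_graph G"
  shows "(simple_polytope (CBP G) \<longleftrightarrow> card {v. cut_vertex G v} \<le> 1) \<and>
         (simplicial_polytope (CBP G) \<longleftrightarrow> card (blocks G) \<le> 2)"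
proof
  note G = assms
  define F where "F = {\<A>. \<A> \<subseteq> blocks G \<and> connected_graph (union_graph \<A>)}"
  have CBP: "CBP G = convex hull (char_vec ` F)"
    unfolding CBP_def F_def by (simp add: setcompr_eq_image incidence_vector_eq_char_vec)
  have conn: "connected_graph B" and ne: "verts B \<noteq> {}" if "B \<in> blocks G" for B
    using that G connected_block verts_block_nonempty by blast+
  have F_sub: "S \<subseteq> blocks G" if "S \<in> F" for S
    using that by (simp add: F_def)
  \<comment> \<open>For \<open>A = B\<close> the condition asks that each member has a vertex, which
    \<open>ne\<close> provides for blocks.\<close>
  have F_pairwise: "S \<in> F" if "S \<subseteq> blocks G" "\<And>A B. A \<in> S \<Longrightarrow> B \<in> S \<Longrightarrow> verts A \<inter> verts B \<noteq> {}" for S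
  proof -
    have "connected_graph (union_graph S)"
      using that(1) conn by (intro connected_graph_union_pairwise that(2)) blast+
    then show ?thesis
      using that(1) by (simp add: F_def)
  qed
  have F_empty: "{} \<in> F"
    by (rule F_pairwise) auto
  have F_single: "{B} \<in> F" if "B \<in> blocks G" for B
    using that ne by (intro F_pairwise) blast+
  have F_pair: "{A, B} \<in> F" if "A \<in> blocks G" "B \<in> blocks G" "verts A \<inter> verts B \<noteq> {}" for A B
    using that ne by (intro F_pairwise) blast+
  have dim: "aff_dim (CBP G) = card (blocks G)"
    unfolding CBP using F_sub F_empty F_single by (rule aff_dim_char_hull)

  show "simple_polytope (CBP G) \<longleftrightarrow> card {v. cut_vertex G v} \<le> 1"
  proof (cases "\<forall>A\<in>blocks G. \<forall>B\<in>blocks G. verts A \<inter> verts B \<noteq> {}")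
    case True
    then have "S \<in> F" if "S \<subseteq> blocks G" for S
      using that by (intro F_pairwise) blast+
    then have "F = Pow (blocks G)"
      using F_sub by blast
    then have "simple_polytope (CBP G)"
      unfolding CBP by (simp only: simple_polytope_cube)
    then show ?thesis
      using True card_cut_vertices_le_1_iff[OF G] by blast
  next
    case False
    then obtain A C where AC: "A \<in> blocks G" "C \<in> blocks G" "verts A \<inter> verts C = {}"
      by blast
    then obtain B D where BD: "B \<in> blocks G" "D \<in> blocks G" "verts A \<inter> verts B \<noteq> {}"
      "verts B \<inter> verts D \<noteq> {}" "verts A \<inter> verts D = {}"
      by (rule disjoint_blocks_induced_path[OF G])
    have "A \<noteq> B" "B \<noteq> D" "A \<noteq> D"
      using BD ne[OF AC(1)] by auto
    moreover have "{A, D} \<notin> F"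
      using not_connected_graph_disjoint_union[of A D] block_subgraph[OF G(1)] ne AC BD
      by (simp add: F_def subgraph_def)
    \<comment> \<open>Since \<open>A\<close> and \<open>D\<close> are disjoint, the pairwise
      criterion is applied to the two graphs \<open>?W\<close> and \<open>D\<close>, after merging
      \<open>A\<close> and \<open>B\<close> into \<open>?W\<close>.\<close>
    moreover have "{A, B, D} \<in> F"
    proof -
      let ?W = "union_graph {A, B}"
      have "connected_graph ?W"
        using F_pair[of A B] AC BD by (simp add: F_def)
      moreover have "verts ?W \<inter> verts D \<noteq> {}" "verts ?W \<noteq> {}"
        using BD ne by (auto simp: union_graph_def)
      ultimately have "connected_graph (union_graph {?W, D})"
        using conn[OF BD(2)] ne[OF BD(2)] by (intro connected_graph_union_pairwise) blast+
      also have "union_graph {?W, D} = union_graph {A, B, D}"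
        by (simp add: union_graph_def Un_assoc)
      finally show ?thesis
        using AC BD by (simp add: F_def)
    qed
    \<comment> \<open>The end \<open>D\<close> of the induced path takes the place of
      \<open>C\<close> in the criterion.\<close>
    ultimately have "\<not> simple_polytope (CBP G)"
      unfolding CBP using F_sub F_empty F_single F_pair[OF AC(1) BD(1,3)] AC BD
      by (intro not_simple_char_hull[of F "blocks G" A D B]) auto
    then show ?thesis
      using False card_cut_vertices_le_1_iff[OF G] by blast
  qed

  show "simplicial_polytope (CBP G) \<longleftrightarrow> card (blocks G) \<le> 2"
  proof (cases "card (blocks G) \<le> 2")
    case True
    moreover have "polytope (CBP G)"
      unfolding CBP by (rule polytope_char_hull)
    ultimately show ?thesis
      using dim by (auto intro: simplicial_polytope_aff_dim_le_2)
  next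
    case False
    then have "blocks G \<noteq> {}" by auto
    then obtain A where A: "A \<in> blocks G"
      by blast
    moreover have "{A} \<noteq> blocks G"
    proof
      assume "{A} = blocks G"
      then have "card (blocks G) = card {A}" by simp
      with False show False by simp
    qed
    ultimately obtain B where "B \<in> blocks G - {A}" "verts A \<inter> verts B \<noteq> {}"
      using blocks_linked[OF G, of "{A}"]
      by (metis bot_least insert_not_empty insert_subset singletonD)
    then have B: "B \<in> blocks G" "A \<noteq> B" "verts A \<inter> verts B \<noteq> {}"
      by auto
    have "card {A, B} < card (blocks G)"
      using B False by simp
    then have "\<not> blocks G \<subseteq> {A, B}"
      using card_mono[of "{A, B}" "blocks G"] by auto
    then obtain C where C: "C \<in> blocks G" "C \<noteq> A" "C \<noteq> B" by blast
    have "\<not> simplicial_polytope (CBP G)"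
      unfolding CBP using F_empty F_single F_pair A B C
      by (intro not_simplicial_char_hull[of F A B C]) auto
    with False show ?thesis by blast
  qed
qed

end
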